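(* Let $G$ be a finitely generated group which lies in at least one of the following classes: 1. free groups; 2. solvable groups; 3. groups having only finitely many distinct (i.e. pairwise non-isomorphic) finite simple quotients; 4. groups generated by two elements, where these two generators have finite and coprime orders. Then $G$ is finitely annihilated if and only if the abelianisation $G^{\mathrm{ab}}$ is non-cyclic.
   Context: An element $g$ of a group $G$ is finitely annihilated if there is a finite group $H_g$ and a homomorphism $\phi_g: G\to H_g$ with $\phi_g(g)=e$ and $\mathrm{Im}(\phi_g)\neq\{e\}$. A non-trivial group $G$ is finitely annihilated (F-A) if all its non-trivial elements are finitely annihilated; equivalently, $G$ is the union of all its proper, normal, finite index subgroups. The trivial group is by convention not F-A. $G^{\mathrm{ab}}=G/G'$ where $G'$ is the derived subgroup. The trivial group is regarded as cyclic. *)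

theory Defs
  imports "HOL-Algebra.Algebra"
begin

section \<open>Finitely annihilated groups\<close>

text \<open>
  The finite group \<open>H\<close> is taken with carrier in \<^typ>\<open>nat\<close>. As every finite group is isomorphic
  to such a group, this is no restriction; see \<open>finitely_annihilated_elemI\<close> below.
\<close>

definition finitely_annihilated_elem :: "('a, 'b) monoid_scheme \<Rightarrow> 'a \<Rightarrow> bool" where
  "finitely_annihilated_elem G g \<longleftrightarrow>
     (\<exists>(H :: nat monoid) \<phi>. group H \<and> finite (carrier H) \<and> \<phi> \<in> hom G H \<and>
        \<phi> g = \<one>\<^bsub>H\<^esub> \<and> \<phi> ` carrier G \<noteq> {\<one>\<^bsub>H\<^esub>})"

definition finitely_annihilated :: "('a, 'b) monoid_scheme \<Rightarrow> bool" where
  "finitely_annihilated G \<longleftrightarrow>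
     carrier G \<noteq> {\<one>\<^bsub>G\<^esub>} \<and> (\<forall>g \<in> carrier G - {\<one>\<^bsub>G\<^esub>}. finitely_annihilated_elem G g)"

lemma finitely_annihilated_elemI:
  fixes G :: "('a, 'b) monoid_scheme" and H :: "('c, 'd) monoid_scheme"
  assumes H: "group H" "finite (carrier H)" and \<phi>: "\<phi> \<in> hom G H" "group G" "g \<in> carrier G"
    and g: "\<phi> g = \<one>\<^bsub>H\<^esub>" and im: "\<phi> ` carrier G \<noteq> {\<one>\<^bsub>H\<^esub>}"
  shows "finitely_annihilated_elem G g"
proof -
  interpret H: group H by fact
  obtain e :: "'c \<Rightarrow> nat" where e: "inj_on e (carrier H)"
    using finite_imp_inj_to_nat_seg[OF H(2)] by blast
  define d where "d = inv_into (carrier H) e"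
  have d: "d (e x) = x" if "x \<in> carrier H" for x
    using e that by (simp add: d_def)
  define K where "K = \<lparr>carrier = e ` carrier H,
    monoid.mult = (\<lambda>x y. e (d x \<otimes>\<^bsub>H\<^esub> d y)), one = e \<one>\<^bsub>H\<^esub>\<rparr>"
  have K: "group K"
  proof (rule groupI)
    fix x assume "x \<in> carrier K"
    then obtain a where a: "a \<in> carrier H" "x = e a" by (auto simp: K_def)
    show "\<exists>y\<in>carrier K. y \<otimes>\<^bsub>K\<^esub> x = \<one>\<^bsub>K\<^esub>"
      by (rule bexI[of _ "e (inv\<^bsub>H\<^esub> a)"]) (use a in \<open>auto simp: K_def d\<close>)
  qed (auto simp: K_def d H.m_assoc)
  have \<phi>': "\<phi> x \<in> carrier H" if "x \<in> carrier G" for x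
    using \<phi>(1) that by (auto simp: hom_def)
  have "(e \<circ> \<phi>) \<in> hom G K"
    using \<phi>(1) \<phi>' by (auto simp: hom_def K_def d)
  moreover have "(e \<circ> \<phi>) ` carrier G \<noteq> {\<one>\<^bsub>K\<^esub>}"
  proof
    assume A: "(e \<circ> \<phi>) ` carrier G = {\<one>\<^bsub>K\<^esub>}"
    have "\<phi> x = \<one>\<^bsub>H\<^esub>" if "x \<in> carrier G" for x
    proof -
      have "e (\<phi> x) = e \<one>\<^bsub>H\<^esub>"
        using A that by (auto simp: K_def)
      thus ?thesis using e \<phi>'[OF that] by (auto dest: inj_onD)
    qed
    with im \<phi>(3) show False by force
  qed
  moreover have "(e \<circ> \<phi>) g = \<one>\<^bsub>K\<^esub>" "finite (carrier K)"
    using g H(2) by (auto simp: K_def)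
  ultimately show ?thesis
    using K unfolding finitely_annihilated_elem_def by blast
qed


section \<open>Free groups\<close>

text \<open>
  The free group on \<open>S\<close> consists of the reduced words over \<open>S \<times> UNIV\<close>, where \<open>(s, True)\<close> stands
  for the generator \<open>s\<close> and \<open>(s, False)\<close> for its formal inverse.
\<close>

definition flip_letter :: "'a \<times> bool \<Rightarrow> 'a \<times> bool" where
  "flip_letter x = (fst x, \<not> snd x)"

definition reduced :: "('a \<times> bool) list \<Rightarrow> bool" where
  "reduced w \<longleftrightarrow> successively (\<lambda>x y. y \<noteq> flip_letter x) w"

fun push :: "'a \<times> bool \<Rightarrow> ('a \<times> bool) list \<Rightarrow> ('a \<times> bool) list" where
  "push x [] = [x]"
| "push x (y # w) = (if y = flip_letter x then w else x # y # w)"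

definition free_group :: "'a set \<Rightarrow> ('a \<times> bool) list monoid" where
  "free_group S =
     \<lparr>carrier = {w. set w \<subseteq> S \<times> UNIV \<and> reduced w}, monoid.mult = foldr push, one = []\<rparr>"

text \<open>
  A basis of \<open>G\<close> can always be chosen inside \<open>G\<close>, so it suffices to let \<open>S\<close> range over sets of
  elements of the type of \<open>G\<close>; see \<open>is_free_groupI\<close> below.
\<close>

definition is_free_group :: "('a, 'b) monoid_scheme \<Rightarrow> bool" where
  "is_free_group G \<longleftrightarrow> (\<exists>S :: 'a set. G \<cong> free_group S)"

lemma flip_letter_flip [simp]: "flip_letter (flip_letter x) = x"
  by (simp add: flip_letter_def)

lemma flip_letter_neq [simp]: "flip_letter x \<noteq> x"
  by (cases x) (simp add: flip_letter_def)

lemma reduced_push: "reduced w \<Longrightarrow> reduced (push x w)"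
  by (cases w) (auto simp: reduced_def successively_Cons)

lemma reduced_foldr_push: "reduced v \<Longrightarrow> reduced (foldr push u v)"
  by (induction u) (auto intro: reduced_push)

lemma set_push: "set (push x w) \<subseteq> insert x (set w)"
  by (cases w) auto

lemma set_foldr_push: "set (foldr push u v) \<subseteq> set u \<union> set v"
proof (induction u)
  case (Cons x u)
  thus ?case using set_push[of x "foldr push u v"] by auto
qed auto

lemma set_foldr_push_subset: "set u \<subseteq> A \<Longrightarrow> set v \<subseteq> A \<Longrightarrow> set (foldr push u v) \<subseteq> A"
  using set_foldr_push[of u v] by blast

lemma push_flip_push: "reduced w \<Longrightarrow> push (flip_letter x) (push x w) = w"
  by (cases w rule: remdups_adj.cases) (auto simp: reduced_def)

lemma foldr_push_push:
  assumes "reduced w"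
  shows "foldr push (push x v) w = push x (foldr push v w)"
proof (cases v)
  case (Cons y ys)
  show ?thesis
    using push_flip_push[OF reduced_foldr_push[OF assms], of y ys] Cons
      push_flip_push[OF reduced_foldr_push[OF assms], of "flip_letter x" ys] by auto
qed auto

lemma foldr_push_assoc:
  "reduced w \<Longrightarrow> foldr push (foldr push u v) w = foldr push u (foldr push v w)"
  by (induction u) (auto simp: foldr_push_push)

lemma foldr_push_Nil: "reduced w \<Longrightarrow> foldr push w [] = w"
proof (induction w)
  case (Cons x w)
  thus ?case by (cases w) (auto simp: reduced_def)
qed auto

lemma foldr_push_inverse:
  "reduced v \<Longrightarrow> foldr push (rev (map flip_letter w)) (foldr push w v) = v"
  by (induction w) (auto simp: push_flip_push reduced_foldr_push)

lemma reduced_inverse: "reduced w \<Longrightarrow> reduced (rev (map flip_letter w))"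
  unfolding reduced_def successively_rev successively_map
  by (erule successively_mono) auto

lemma group_free_group: "group (free_group S)"
proof (rule groupI)
  fix w assume w: "w \<in> carrier (free_group S)"
  let ?w = "rev (map flip_letter w)"
  have "?w \<in> carrier (free_group S)"
    using w reduced_inverse[of w] by (auto simp: free_group_def flip_letter_def subset_iff)
  moreover have "?w \<otimes>\<^bsub>free_group S\<^esub> w = \<one>\<^bsub>free_group S\<^esub>"
    using foldr_push_inverse[of "[]" w] w
    by (simp add: free_group_def foldr_push_Nil) (simp add: reduced_def)
  ultimately show "\<exists>y\<in>carrier (free_group S). y \<otimes>\<^bsub>free_group S\<^esub> w = \<one>\<^bsub>free_group S\<^esub>"
    by blast
next
  fix u v assume "u \<in> carrier (free_group S)" "v \<in> carrier (free_group S)"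
  thus "u \<otimes>\<^bsub>free_group S\<^esub> v \<in> carrier (free_group S)"
    using set_foldr_push_subset[of u "S \<times> UNIV" v] by (simp add: free_group_def reduced_foldr_push)
next
  fix u v w assume "w \<in> carrier (free_group S)"
  thus "u \<otimes>\<^bsub>free_group S\<^esub> v \<otimes>\<^bsub>free_group S\<^esub> w = u \<otimes>\<^bsub>free_group S\<^esub> (v \<otimes>\<^bsub>free_group S\<^esub> w)"
    by (simp add: free_group_def foldr_push_assoc)
qed (simp_all add: free_group_def reduced_def)

text \<open>The existence half of the universal property.\<close>

lemma free_group_extend:
  fixes S :: "'a set" and H :: "('c, 'd) monoid_scheme"
  assumes "group H" and f: "f \<in> S \<rightarrow> carrier H"
  shows "\<exists>h \<in> hom (free_group S) H. \<forall>s \<in> S. h [(s, True)] = f s"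
proof -
  interpret H: group H by fact
  define l where "l x = (if snd x then f (fst x) else inv\<^bsub>H\<^esub> (f (fst x)))" for x :: "'a \<times> bool"
  define h where "h w = foldr (\<lambda>x a. l x \<otimes>\<^bsub>H\<^esub> a) w \<one>\<^bsub>H\<^esub>" for w
  have l: "l x \<in> carrier H" if "x \<in> S \<times> UNIV" for x
    using f that by (auto simp: l_def)
  have hc: "h w \<in> carrier H" if "set w \<subseteq> S \<times> UNIV" for w
    using that by (induction w) (auto simp: h_def l)
  have hp: "h (push x w) = l x \<otimes>\<^bsub>H\<^esub> h w" if x: "x \<in> S \<times> UNIV" and w: "set w \<subseteq> S \<times> UNIV" for x w
  proof (cases "\<exists>v. w = flip_letter x # v")
    case True
    then obtain v where v: "w = flip_letter x # v" by blast
    have vc: "h v \<in> carrier H" using w v by (auto intro!: hc)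
    have "l (flip_letter x) \<in> carrier H" using x by (intro l) (auto simp: flip_letter_def)
    moreover have "l x \<otimes>\<^bsub>H\<^esub> l (flip_letter x) = \<one>\<^bsub>H\<^esub>"
      using x f by (auto simp: l_def flip_letter_def Pi_iff)
    ultimately have "l x \<otimes>\<^bsub>H\<^esub> (l (flip_letter x) \<otimes>\<^bsub>H\<^esub> h v) = h v"
      using vc l[OF x] by (simp flip: H.m_assoc)
    thus ?thesis by (simp add: v h_def)
  next
    case False
    thus ?thesis by (cases w) (auto simp: h_def)
  qed
  have hm: "h (foldr push u v) = h u \<otimes>\<^bsub>H\<^esub> h v"
    if "set u \<subseteq> S \<times> UNIV" "set v \<subseteq> S \<times> UNIV" for u v
    using that(1)
  proof (induction u)
    case (Cons x u)
    have "h (x # u) = l x \<otimes>\<^bsub>H\<^esub> h u" by (simp add: h_def)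
    thus ?case
      using Cons l[of x] hc[of u] hc[OF that(2)] hp[of x "foldr push u v"] that(2)
      by (simp add: H.m_assoc set_foldr_push_subset)
  qed (use hc[OF that(2)] in \<open>simp add: h_def\<close>)
  have "h \<in> hom (free_group S) H"
    using hc hm by (auto simp: hom_def free_group_def)
  moreover have "h [(s, True)] = f s" if "s \<in> S" for s
    using f that by (auto simp: h_def l_def Pi_iff)
  ultimately show ?thesis by blast
qed

lemma free_group_cong:
  assumes "bij_betw f S T"
  shows "free_group S \<cong> free_group T"
proof -
  define F where "F = map (map_prod f (id :: bool \<Rightarrow> bool))"
  have inj: "inj_on f S" and im: "f ` S = T" using assms by (auto simp: bij_betw_def)
  have mp: "inj_on (map_prod f id) (S \<times> (UNIV :: bool set))"
    using inj by (auto intro!: inj_onI dest: inj_onD)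
  have fl: "map_prod f id (flip_letter x) = flip_letter (map_prod f id x)" for x
    by (cases x) (simp add: flip_letter_def)
  have fS: "flip_letter x \<in> S \<times> UNIV" if "x \<in> S \<times> UNIV" for x
    using that by (auto simp: flip_letter_def)
  have eq: "map_prod f id y = flip_letter (map_prod f id x) \<longleftrightarrow> y = flip_letter x"
    if "x \<in> S \<times> UNIV" "y \<in> S \<times> UNIV" for x y
    using inj_on_eq_iff[OF mp that(2) fS[OF that(1)]] by (simp add: fl)
  have red: "reduced (F w) \<longleftrightarrow> reduced w" if "set w \<subseteq> S \<times> UNIV" for w
    unfolding reduced_def F_def successively_map
  proof (rule successively_cong)
    fix x y assume "x \<in> set w" "y \<in> set w"
    hence "x \<in> S \<times> UNIV" "y \<in> S \<times> UNIV" using that by auto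
    thus "map_prod f id y \<noteq> flip_letter (map_prod f id x) \<longleftrightarrow> y \<noteq> flip_letter x"
      by (simp only: eq not_False_eq_True)
  qed (rule refl)
  have F_push: "F (push x w) = push (map_prod f id x) (F w)"
    if "x \<in> S \<times> UNIV" "set w \<subseteq> S \<times> UNIV" for x w
  proof (cases w)
    case (Cons y v)
    thus ?thesis using that eq[of x y] by (auto simp: F_def simp del: map_prod_simp)
  qed (simp add: F_def)
  have F_mult: "F (foldr push u v) = foldr push (F u) (F v)"
    if "set u \<subseteq> S \<times> UNIV" "set v \<subseteq> S \<times> UNIV" for u v
    using that(1)
  proof (induction u)
    case (Cons x u)
    have "F (foldr push (x # u) v) = push (map_prod f id x) (F (foldr push u v))"
      using Cons that(2) by (simp add: F_push set_foldr_push_subset)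
    thus ?case using Cons by (simp add: F_def)
  qed (simp add: F_def)
  have "inj_on F (carrier (free_group S))"
    unfolding F_def free_group_def
    by (intro inj_on_mapI inj_on_subset[OF mp]) auto
  moreover have "F ` carrier (free_group S) = carrier (free_group T)"
  proof -
    have A: "F ` {w. set w \<subseteq> S \<times> UNIV} = {w. set w \<subseteq> T \<times> UNIV}"
      using lists_image[of "map_prod f (id :: bool \<Rightarrow> bool)" "S \<times> UNIV"]
        map_prod_surj_on[OF im, of "id :: bool \<Rightarrow> bool" UNIV UNIV]
      by (simp add: F_def lists_eq_set)
    have "carrier (free_group S) = {w. set w \<subseteq> S \<times> UNIV \<and> reduced (F w)}"
      using red by (auto simp: free_group_def)
    also have "F ` \<dots> = F ` {w. set w \<subseteq> S \<times> UNIV} \<inter> {w. reduced w}"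
      by blast
    also have "\<dots> = carrier (free_group T)"
      unfolding A by (auto simp: free_group_def)
    finally show ?thesis .
  qed
  ultimately have "F \<in> iso (free_group S) (free_group T)"
    using F_mult by (auto simp: iso_iff hom_def free_group_def)
  thus ?thesis by (auto simp: is_iso_def)
qed

lemma is_free_groupI:
  fixes G :: "('a, 'b) monoid_scheme" and S :: "'c set"
  assumes "group G" and iso: "G \<cong> free_group S"
  shows "is_free_group G"
proof -
  have "free_group S \<cong> G" using assms group.iso_sym by blast
  then obtain h where h: "h \<in> iso (free_group S) G" by (auto simp: is_iso_def)
  define f where "f s = h [(s, True)]" for s
  have "inj_on h (carrier (free_group S))"
    using h by (auto simp: iso_iff)
  hence "inj_on f S"
    by (intro inj_onI) (auto simp: f_def free_group_def reduced_def dest: inj_onD)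
  hence "free_group S \<cong> free_group (f ` S)"
    by (intro free_group_cong) (simp add: bij_betw_def)
  thus ?thesis using iso iso_trans unfolding is_free_group_def by blast
qed


section \<open>The remaining classes of groups\<close>

definition finitely_generated_group :: "('a, 'b) monoid_scheme \<Rightarrow> bool" where
  "finitely_generated_group G \<longleftrightarrow>
     (\<exists>S. finite S \<and> S \<subseteq> carrier G \<and> generate G S = carrier G)"

definition finite_simple_quotients :: "('a, 'b) monoid_scheme \<Rightarrow> 'a set monoid set" where
  "finite_simple_quotients G =
     {G Mod N | N. N \<lhd> G \<and> finite (carrier (G Mod N)) \<and> simple_group (G Mod N)}"

definition fin_many_finite_simple_quotients :: "('a, 'b) monoid_scheme \<Rightarrow> bool" where
  "fin_many_finite_simple_quotients G \<longleftrightarrow>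
     finite (finite_simple_quotients G //
       {(P, Q). P \<in> finite_simple_quotients G \<and> Q \<in> finite_simple_quotients G \<and> P \<cong> Q})"

text \<open>
  \<^const>\<open>group.ord\<close> is \<open>0\<close> on elements of infinite order, so finiteness of the orders is
  expressed by positivity.
\<close>

definition coprime_two_generated :: "('a, 'b) monoid_scheme \<Rightarrow> bool" where
  "coprime_two_generated G \<longleftrightarrow>
     (\<exists>x \<in> carrier G. \<exists>y \<in> carrier G. generate G {x, y} = carrier G \<and>
        group.ord G x > 0 \<and> group.ord G y > 0 \<and> coprime (group.ord G x) (group.ord G y))"

definition abelianisation :: "('a, 'b) monoid_scheme \<Rightarrow> 'a set monoid" where
  "abelianisation G = G Mod derived G (carrier G)"

end

theory Submission
  imports Defs
begin

text \<open>
  Everything is phrased through normal subgroups of finite index: an element of \<open>G\<close> is finitely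
  annihilated iff it lies in a proper one. So a non-trivial \<open>G\<close> fails to be finitely annihilated
  iff some element other than \<open>\<one>\<close> escapes all of them. The link to the abelianisation is made by
  the elements \<open>g\<close> whose coset generates \<open>G/G'\<close>, that is, the \<open>g\<close> contained in no proper normal
  subgroup above \<open>G'\<close> (\<open>cyclic_abelianisation_iff\<close>).

  Suppose the abelianisation is not cyclic, and let \<open>g\<close> be any element. Some proper \<open>N\<close> above
  \<open>G'\<close> contains \<open>g\<close>. As \<open>G\<close> is finitely generated, \<open>N\<close> can be enlarged, by adding all but one
  member of a suitable finite set, until \<open>G/N\<close> is cyclic and non-trivial. A non-trivial cyclic
  group has a quotient of prime order, and the map of \<open>G\<close> onto it annihilates \<open>g\<close>.

  Conversely, let \<open>g\<close> generate \<open>G\<close> modulo \<open>G'\<close>. Each class of groups has its own reason for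
  containing an element that no proper normal subgroup of finite index contains.
  \<^item> Free groups: two different basis elements would give two independent homomorphisms to the
    integers, and a non-zero combination of them would vanish at \<open>g\<close>. So there is at most one basis
    element, \<open>G\<close> is cyclic, and a generator of \<open>G\<close> will do.
  \<^item> Solvable groups: if \<open>g \<in> N\<close> then \<open>G/N\<close> is perfect as well as solvable, hence trivial. So \<open>g\<close>
    itself will do.
  \<^item> Finitely many finite simple quotients: finite generation leaves finitely many kernels of
    such quotients. Kernels with a non-abelian quotient behave like prime ideals, so an argument in
    the manner of prime avoidance moves \<open>g\<close> within \<open>G'g\<close> out of all of them. Those with an abelian
    quotient contain \<open>G'\<close> and are therefore avoided by the whole coset \<open>G'g\<close>.
  \<^item> Generators \<open>x\<close>, \<open>y\<close> of finite coprime orders: if \<open>xy\<close> dies in a quotient, then the images of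
    \<open>x\<close> and \<open>y\<close> are mutually inverse, have equal and coprime orders, and so die too. So \<open>xy\<close> will do.
\<close>

section \<open>Quotients, homomorphisms and generators\<close>

lemma (in group) group_hom_Mod:
  assumes "N \<lhd> G"
  shows "group_hom G (G Mod N) (\<lambda>x. N #> x)"
  using assms normal.r_coset_hom_Mod normal.factorgroup_is_group
  by (auto simp: group_hom_def group_hom_axioms_def)

lemma (in group) rcoset_eq_self_iff:
  assumes "subgroup N G" "x \<in> carrier G"
  shows "N #> x = N \<longleftrightarrow> x \<in> N"
  using assms coset_join1 coset_join2 by blast

lemma (in group) trivial_Mod_imp_eq_carrier:
  assumes "N \<lhd> G" "carrier (G Mod N) = {N}"
  shows "N = carrier G"
proof -
  have "x \<in> N" if "x \<in> carrier G" for x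
    using assms that rcoset_eq_self_iff[of N x] by (auto simp: carrier_FactGroup normal_imp_subgroup)
  thus ?thesis using assms(1) subgroup.subset[OF normal_imp_subgroup] by blast
qed

lemma (in group) subgroup_eq_carrierI:
  assumes "subgroup H G" "S \<subseteq> H" "generate G S = carrier G"
  shows "H = carrier G"
  using assms generate_subgroup_incl subgroup.subset by blast

lemma hom_eq_on_generators:
  assumes "group G" "group H" "f \<in> hom G H" "h \<in> hom G H" "S \<subseteq> carrier G" "generate G S = carrier G"
    and eq: "\<And>s. s \<in> S \<Longrightarrow> f s = h s" and "x \<in> carrier G"
  shows "f x = h x"
proof -
  interpret f: group_hom G H f using assms by (simp add: group_hom_def group_hom_axioms_def)
  interpret h: group_hom G H h using assms by (simp add: group_hom_def group_hom_axioms_def)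
  have "subgroup {x \<in> carrier G. f x = h x} G"
    by (rule f.G.subgroupI) (use f.one_closed in auto)
  from f.G.subgroup_eq_carrierI[OF this _ assms(6)] assms(5,8) eq show ?thesis by blast
qed

text \<open>
  Conjugating \<open>h\<close> by \<open>x\<close> multiplies it by a commutator, which \<open>N\<close> contains.
\<close>

lemma (in group) normal_if_derived_subset:
  assumes "subgroup N G" "derived G (carrier G) \<subseteq> N"
  shows "N \<lhd> G"
proof (rule normal_invI[OF assms(1)])
  fix x h assume x: "x \<in> carrier G" and h: "h \<in> N"
  have hc: "h \<in> carrier G" using subgroup.mem_carrier[OF assms(1) h] .
  have "x \<otimes> h \<otimes> inv x \<otimes> inv h \<in> derived G (carrier G)"
    unfolding derived_def using x hc by (intro generate.incl) blast
  hence "x \<otimes> h \<otimes> inv x \<otimes> inv h \<otimes> h \<in> N"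
    using subgroup.m_closed[OF assms(1) subsetD[OF assms(2)] h] by simp
  thus "x \<otimes> h \<otimes> inv x \<in> N" using x hc by (simp add: m_assoc)
qed

section \<open>Finite annihilation through normal subgroups of finite index\<close>

text \<open>
  One element outside all proper normal subgroups of finite index refutes finite annihilation. The
  definition quantifies over \<open>g \<noteq> \<one>\<close> only, but \<open>g = \<one>\<close> is allowed here: then there are no proper
  normal subgroups of finite index at all, and any other element serves as the witness.
\<close>

lemma (in group) not_finitely_annihilatedI:
  assumes g: "g \<in> carrier G"
    and full: "\<And>N. N \<lhd> G \<Longrightarrow> finite (carrier (G Mod N)) \<Longrightarrow> g \<in> N \<Longrightarrow> N = carrier G"
  shows "\<not> finitely_annihilated G"
proof
  assume fa: "finitely_annihilated G"
  define x where "x = (if g = \<one> then (SOME x. x \<in> carrier G - {\<one>}) else g)"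
  have "\<exists>x. x \<in> carrier G - {\<one>}" using fa by (auto simp: finitely_annihilated_def)
  hence "x \<in> carrier G - {\<one>}"
    using g someI_ex[of "\<lambda>x. x \<in> carrier G - {\<one>}"] by (auto simp: x_def)
  then obtain H :: "nat monoid" and \<phi> where H: "group H" "finite (carrier H)" "\<phi> \<in> hom G H"
    "\<phi> x = \<one>\<^bsub>H\<^esub>" "\<phi> ` carrier G \<noteq> {\<one>\<^bsub>H\<^esub>}" and x: "x \<in> carrier G"
    using fa unfolding finitely_annihilated_def finitely_annihilated_elem_def by blast
  interpret \<phi>: group_hom G H \<phi> using H by (simp add: group_hom_def group_hom_axioms_def)
  let ?N = "kernel G H \<phi>"
  have "finite (carrier (G Mod ?N))"
    using \<phi>.FactGroup_inj_on
    by (rule finite_imageD[rotated]) (rule finite_subset[OF _ H(2)], auto intro: \<phi>.FactGroup_the_elem_mem)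
  moreover have "g \<in> ?N"
    using H(4) g by (cases "g = \<one>") (auto simp: kernel_def x_def)
  ultimately have "?N = carrier G" using full \<phi>.normal_kernel by blast
  thus False using H(5) \<phi>.trivial_hom_iff by blast
qed

text \<open>
  The quotient \<open>C = G/N\<close> is cyclic, generated by the coset \<open>c\<close> of \<open>t\<close>, and not trivial. Its
  subgroup \<open>P\<close> of \<open>p\<close>-th powers has at most \<open>p\<close> cosets, and it misses \<open>c\<close> for every prime \<open>p\<close>
  dividing the order of \<open>c\<close>. Then \<open>C/P\<close> is a finite quotient of \<open>G\<close> that annihilates \<open>N\<close>.
\<close>

lemma (in group) finitely_annihilated_elem_if_proper_cyclic_quotient:
  assumes N: "N \<lhd> G" "N \<noteq> carrier G" and g: "g \<in> N"
    and t: "t \<in> carrier G" "generate G (insert t N) = carrier G"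
  shows "finitely_annihilated_elem G g"
proof -
  interpret N: normal N G by fact
  interpret \<pi>: group_hom G "G Mod N" "\<lambda>x. N #> x" using group_hom_Mod N by blast
  define C where "C = G Mod N"
  interpret C: group C unfolding C_def by (rule N.factorgroup_is_group)
  define c where "c = N #> t"
  have c: "c \<in> carrier C" using t by (auto simp: C_def c_def carrier_FactGroup)
  have "carrier C = (\<lambda>x. N #> x) ` generate G (insert t N)"
    by (simp add: C_def t carrier_FactGroup)
  also have "\<dots> = generate C ((\<lambda>x. N #> x) ` insert t N)"
    unfolding C_def by (rule \<pi>.generate_img[symmetric]) (use t N.subset in auto)
  also have "\<dots> \<subseteq> generate C {c}"
  proof (rule C.generate_subgroup_incl)
    have "N #> x = \<one>\<^bsub>C\<^esub>" if "x \<in> N" for x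
      using that N.subset rcoset_eq_self_iff[of N x] N.is_subgroup by (auto simp: C_def)
    thus "(\<lambda>x. N #> x) ` insert t N \<subseteq> generate C {c}"
      by (auto simp: c_def intro: generate.incl generate.one)
  qed (use c in \<open>auto intro: C.generate_is_subgroup\<close>)
  finally have pow: "\<exists>n::int. x = c [^]\<^bsub>C\<^esub> n" if "x \<in> carrier C" for x
    using that C.generate_pow[OF c] by auto
  have "c \<noteq> \<one>\<^bsub>C\<^esub>"
  proof
    assume "c = \<one>\<^bsub>C\<^esub>"
    hence "carrier C = {\<one>\<^bsub>C\<^esub>}" using pow by auto
    thus False using trivial_Mod_imp_eq_carrier N by (simp add: C_def)
  qed
  hence "C.ord c \<noteq> 1" using C.ord_eq_1 c by blast
  \<comment> \<open>An element of infinite order has order \<open>0\<close>, which every prime divides, so that the infinite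
      and the finite case need no separate treatment.\<close>
  then obtain p where p: "Factorial_Ring.prime p" "p dvd C.ord c" using prime_factor_nat by blast
  define P where "P = range (\<lambda>n::int. c [^]\<^bsub>C\<^esub> (int p * n))"
  have comm: "comm_group C"
  proof (rule C.group_comm_groupI)
    fix x y assume "x \<in> carrier C" "y \<in> carrier C"
    thus "x \<otimes>\<^bsub>C\<^esub> y = y \<otimes>\<^bsub>C\<^esub> x" using pow[of x] pow[of y] c
      by (auto simp: add.commute simp flip: C.int_pow_mult)
  qed
  have "subgroup P C"
  proof (rule C.subgroupI)
    fix a b assume "a \<in> P" "b \<in> P"
    then obtain m n :: int where "a = c [^]\<^bsub>C\<^esub> (int p * m)" "b = c [^]\<^bsub>C\<^esub> (int p * n)"
      by (auto simp: P_def)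
    hence "a \<otimes>\<^bsub>C\<^esub> b = c [^]\<^bsub>C\<^esub> (int p * (m + n))" "inv\<^bsub>C\<^esub> a = c [^]\<^bsub>C\<^esub> (int p * (- m))"
      using c by (simp_all add: C.int_pow_mult C.int_pow_neg algebra_simps)
    thus "a \<otimes>\<^bsub>C\<^esub> b \<in> P" "inv\<^bsub>C\<^esub> a \<in> P" unfolding P_def by blast+
  qed (use c in \<open>auto simp: P_def\<close>)
  hence P: "P \<lhd> C" using comm comm_group.normal_iff_subgroup by blast
  have "c \<notin> P"
  proof
    assume "c \<in> P"
    then obtain n :: int where "c [^]\<^bsub>C\<^esub> (1::int) = c [^]\<^bsub>C\<^esub> (int p * n)" using c by (auto simp: P_def)
    hence "int (C.ord c) dvd int p * n - 1" using C.int_pow_eq c by metis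
    hence "int p dvd int p * n - 1" using p(2) by (meson dvd_trans int_dvd_int_iff)
    hence "int p dvd 1" by (metis dvd_diff_right_iff dvd_triv_left)
    thus False using p(1) by (simp add: prime_gt_1_nat)
  qed
  have fin: "finite (carrier (C Mod P))"
  proof (rule finite_subset)
    show "carrier (C Mod P) \<subseteq> (\<lambda>r. P #>\<^bsub>C\<^esub> c [^]\<^bsub>C\<^esub> r) ` {0..<int p}"
    proof
      fix Y assume "Y \<in> carrier (C Mod P)"
      then obtain n :: int where n: "Y = P #>\<^bsub>C\<^esub> c [^]\<^bsub>C\<^esub> n" using pow by (auto simp: carrier_FactGroup)
      have "c [^]\<^bsub>C\<^esub> n = c [^]\<^bsub>C\<^esub> (int p * (n div int p)) \<otimes>\<^bsub>C\<^esub> c [^]\<^bsub>C\<^esub> (n mod int p)"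
        using c by (simp flip: C.int_pow_mult)
      moreover have "c [^]\<^bsub>C\<^esub> (int p * (n div int p)) \<in> P" by (auto simp: P_def)
      ultimately have "Y = P #>\<^bsub>C\<^esub> c [^]\<^bsub>C\<^esub> (n mod int p)"
        using n c C.coset_mult_assoc[of P "c [^]\<^bsub>C\<^esub> (int p * (n div int p))" "c [^]\<^bsub>C\<^esub> (n mod int p)"]
          C.coset_join2[of "c [^]\<^bsub>C\<^esub> (int p * (n div int p))" P] \<open>subgroup P C\<close> subgroup.subset
        by fastforce
      thus "Y \<in> (\<lambda>r. P #>\<^bsub>C\<^esub> c [^]\<^bsub>C\<^esub> r) ` {0..<int p}"
        using prime_gt_0_nat[OF p(1)] by auto
    qed
  qed simp
  let ?\<phi> = "\<lambda>x. P #>\<^bsub>C\<^esub> (N #> x)"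
  have "?\<phi> \<in> hom G (C Mod P)"
    using Group.hom_compose[OF N.r_coset_hom_Mod normal.r_coset_hom_Mod[OF P, unfolded C_def]]
    by (simp add: C_def comp_def)
  moreover have "?\<phi> g = \<one>\<^bsub>C Mod P\<^esub>"
  proof -
    have "N #> g = \<one>\<^bsub>C\<^esub>" using g N.subset rcoset_eq_self_iff[of N g] N.is_subgroup by (auto simp: C_def)
    thus ?thesis using C.coset_mult_one[of P] \<open>subgroup P C\<close> subgroup.subset by (simp add: subgroup.subset)
  qed
  moreover have "?\<phi> ` carrier G \<noteq> {\<one>\<^bsub>C Mod P\<^esub>}"
  proof
    assume "?\<phi> ` carrier G = {\<one>\<^bsub>C Mod P\<^esub>}"
    hence "P #>\<^bsub>C\<^esub> c = P" using t by (auto simp: c_def)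
    thus False using C.rcoset_eq_self_iff \<open>subgroup P C\<close> c \<open>c \<notin> P\<close> by blast
  qed
  ultimately show ?thesis
    by (intro finitely_annihilated_elemI[OF normal.factorgroup_is_group[OF P] fin, of ?\<phi>])
      (use g N.subset is_group in \<open>simp_all add: subset_iff\<close>)
qed

section \<open>Non-cyclic abelianisation\<close>

text \<open>
  The coset of \<open>g\<close> generates \<open>G/G'\<close>. This form mentions neither cosets nor powers, and is what a
  normal subgroup containing \<open>g\<close> can be tested against.
\<close>

definition generates_abelianisation :: "('a, 'b) monoid_scheme \<Rightarrow> 'a \<Rightarrow> bool" where
  "generates_abelianisation G g \<longleftrightarrow> g \<in> carrier G \<and>
     (\<forall>N. N \<lhd> G \<longrightarrow> derived G (carrier G) \<subseteq> N \<longrightarrow> g \<in> N \<longrightarrow> N = carrier G)"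

lemma (in group) cyclic_abelianisation_iff:
  "cyclic_group (abelianisation G) \<longleftrightarrow> (\<exists>g. generates_abelianisation G g)"
proof -
  let ?D = "derived G (carrier G)"
  have D: "?D \<lhd> G" by (rule derived_self_is_normal)
  then interpret D: normal ?D G .
  interpret \<pi>: group_hom G "G Mod ?D" "\<lambda>x. ?D #> x" using group_hom_Mod D by blast
  have cyc: "cyclic_group (G Mod ?D) \<longleftrightarrow>
      (\<exists>g \<in> carrier G. carrier (G Mod ?D) = generate (G Mod ?D) {?D #> g})"
    unfolding group.cyclic_group[OF \<pi>.H.is_group] carrier_FactGroup
    by (auto simp: \<pi>.H.generate_pow carrier_FactGroup full_SetCompr_eq)
  show ?thesis unfolding abelianisation_def cyc
  proof safe
    fix g assume g: "g \<in> carrier G" "carrier (G Mod ?D) = generate (G Mod ?D) {?D #> g}"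
    have "N = carrier G" if N: "N \<lhd> G" "?D \<subseteq> N" "g \<in> N" for N
    proof -
      interpret N: normal N G by fact
      have "x \<in> N" if x: "x \<in> carrier G" for x
      proof -
        have "?D #> x \<in> generate (G Mod ?D) ((\<lambda>x. ?D #> x) ` {g})"
          using x g by (auto simp: carrier_FactGroup)
        hence "?D #> x \<in> (\<lambda>x. ?D #> x) ` generate G {g}"
          using g by (subst (asm) \<pi>.generate_img) auto
        then obtain y where y: "y \<in> generate G {g}" "?D #> x = ?D #> y" by auto
        have "y \<in> N" using y(1) N(3) generate_subgroup_incl[of "{g}" N] N.is_subgroup by auto
        moreover have "x \<in> ?D #> y" using y(2) x D.is_subgroup rcos_self by metis
        ultimately show ?thesis using N(2) by (auto simp: r_coset_def)
      qed
      thus ?thesis using N.subset by blast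
    qed
    thus "\<exists>g. generates_abelianisation G g" using g unfolding generates_abelianisation_def by blast
  next
    fix g assume g: "generates_abelianisation G g"
    hence gc: "g \<in> carrier G" by (simp add: generates_abelianisation_def)
    let ?N = "generate G (insert g ?D)"
    have sub: "insert g ?D \<subseteq> ?N" by (auto intro: generate.incl)
    have "subgroup ?N G" using gc D.subset by (intro generate_is_subgroup) auto
    hence "?N \<lhd> G" using sub normal_if_derived_subset by blast
    hence N: "?N = carrier G" using g sub by (auto simp: generates_abelianisation_def)
    have "carrier (G Mod ?D) = (\<lambda>x. ?D #> x) ` ?N" unfolding N by (simp add: carrier_FactGroup)
    also have "\<dots> = generate (G Mod ?D) ((\<lambda>x. ?D #> x) ` insert g ?D)"
      by (rule \<pi>.generate_img[symmetric]) (use gc D.subset in auto)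
    also have "\<dots> \<subseteq> generate (G Mod ?D) {?D #> g}"
    proof (rule \<pi>.H.generate_subgroup_incl)
      have "?D #> x = \<one>\<^bsub>G Mod ?D\<^esub>" if "x \<in> ?D" for x
        using that D.subset rcoset_eq_self_iff[of ?D x] D.is_subgroup by auto
      thus "(\<lambda>x. ?D #> x) ` insert g ?D \<subseteq> generate (G Mod ?D) {?D #> g}"
        by (auto intro: generate.incl generate.one[of "G Mod ?D", simplified])
    qed (use gc in \<open>auto intro!: \<pi>.H.generate_is_subgroup simp: carrier_FactGroup\<close>)
    finally show "\<exists>g \<in> carrier G. carrier (G Mod ?D) = generate (G Mod ?D) {?D #> g}"
      using gc \<pi>.H.generate_incl[of "{?D #> g}"] \<pi>.hom_closed by blast
  qed
qed

text \<open>
  Among the subsets of a finite generating set that generate \<open>G\<close> together with \<open>N\<close>, take a minimal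
  one. It is non-empty because \<open>N\<close> is proper; omitting one of its members \<open>t\<close> leads to a larger
  proper subgroup \<open>Q\<close> such that \<open>G/Q\<close> is generated by the coset of \<open>t\<close>.
\<close>

lemma (in group) finitely_annihilated_elem_if_abelianisation_not_generated:
  assumes fg: "finitely_generated_group G"
    and g: "g \<in> carrier G" "\<not> generates_abelianisation G g"
  shows "finitely_annihilated_elem G g"
proof -
  obtain N where N: "N \<lhd> G" "derived G (carrier G) \<subseteq> N" "g \<in> N" "N \<noteq> carrier G"
    using g unfolding generates_abelianisation_def by blast
  interpret N: normal N G by fact
  obtain S where S: "finite S" "S \<subseteq> carrier G" "generate G S = carrier G"
    using fg unfolding finitely_generated_group_def by blast
  define F where "F = {T. T \<subseteq> S \<and> generate G (N \<union> T) = carrier G}"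
  have "S \<in> F"
    using S mono_generate[of S "N \<union> S"] generate_incl[of "N \<union> S"] N.subset by (auto simp: F_def)
  moreover have "finite F" using S(1) by (simp add: F_def)
  ultimately obtain T where "T \<in> F" and min: "\<forall>U\<in>F. U \<subseteq> T \<longrightarrow> T = U"
    using finite_has_minimal2[of F S] by blast
  hence T: "T \<subseteq> S" "generate G (N \<union> T) = carrier G" by (simp_all add: F_def)
  have "generate G N = N" using generateI[OF N.is_subgroup order_refl] by blast
  hence "T \<noteq> {}" using T(2) N(4) by auto
  then obtain t where t: "t \<in> T" by blast
  let ?Q = "generate G (N \<union> (T - {t}))"
  have sub: "N \<union> (T - {t}) \<subseteq> carrier G" using N.subset T(1) S(2) by auto
  have NQ: "N \<union> (T - {t}) \<subseteq> ?Q" by (auto intro: generate.incl)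
  have "?Q \<lhd> G"
    using normal_if_derived_subset[OF generate_is_subgroup[OF sub]] NQ N(2) by blast
  moreover have "?Q \<noteq> carrier G" 
  proof
    assume "?Q = carrier G"
    hence "T - {t} \<in> F" using T(1) by (auto simp: F_def)
    thus False using min t by blast
  qed
  moreover have "generate G (insert t ?Q) = carrier G"
  proof
    have "carrier G = generate G (N \<union> T)" using T(2) by simp
    also have "\<dots> \<subseteq> generate G (insert t ?Q)" using NQ t by (intro mono_generate) blast
    finally show "carrier G \<subseteq> generate G (insert t ?Q)" .
    show "generate G (insert t ?Q) \<subseteq> carrier G"
      using generate_incl[OF sub] t T(1) S(2) by (intro generate_incl) blast
  qed
  moreover have "g \<in> ?Q" "t \<in> carrier G" using NQ N(3) t T(1) S(2) by auto
  ultimately show ?thesis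
    using finitely_annihilated_elem_if_proper_cyclic_quotient by blast
qed


section \<open>Cyclic abelianisation\<close>

text \<open>
  The kernel of a homomorphism to an abelian group contains \<open>G'\<close>, so it cannot contain \<open>g\<close> unless
  it is everything.
\<close>

lemma (in group) hom_trivial_if_kills_abelianisation_generator:
  assumes g: "generates_abelianisation G g" and A: "comm_group A"
    and h: "h \<in> hom G A" "h g = \<one>\<^bsub>A\<^esub>" and x: "x \<in> carrier G"
  shows "h x = \<one>\<^bsub>A\<^esub>"
proof -
  interpret A: comm_group A by fact
  interpret h: group_hom G A h
    using h by (simp add: group_hom_def group_hom_axioms_def A.is_group)
  have "h ` derived G (carrier G) = derived A (h ` carrier G)"
    by (rule h.derived_img[symmetric]) simp
  also have "\<dots> = {\<one>\<^bsub>A\<^esub>}" by (rule A.derived_eq_singleton) auto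
  finally have "derived G (carrier G) \<subseteq> kernel G A h"
    using derived_in_carrier[of "carrier G"] by (auto simp: kernel_def)
  moreover have "g \<in> kernel G A h"
    using g h(2) by (simp add: kernel_def generates_abelianisation_def)
  ultimately have "kernel G A h = carrier G"
    using g h.normal_kernel unfolding generates_abelianisation_def by blast
  thus ?thesis using x unfolding kernel_def by blast
qed

section \<open>Free groups\<close>

lemma generate_free_group:
  "generate (free_group S) ((\<lambda>s. [(s, True)]) ` S) = carrier (free_group S)" (is "?gen = _")
proof
  interpret F: group "free_group S" by (rule group_free_group)
  have gens: "(\<lambda>s. [(s, True)]) ` S \<subseteq> carrier (free_group S)"
    by (auto simp: free_group_def reduced_def)
  thus "?gen \<subseteq> carrier (free_group S)" by (rule F.generate_incl)
  have letter: "[x] \<in> ?gen" if "x \<in> S \<times> UNIV" for x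
  proof (cases "snd x")
    case True
    thus ?thesis using that by (intro generate.incl) (cases x, auto)
  next
    case False
    with that obtain s where s: "s \<in> S" "x = (s, False)" by (cases x) auto
    have "inv\<^bsub>free_group S\<^esub> [(s, True)] = [(s, False)]"
      using s(1) by (intro F.inv_equality) (auto simp: free_group_def reduced_def flip_letter_def)
    thus ?thesis using s generate.inv[of "[(s, True)]" "(\<lambda>s. [(s, True)]) ` S" "free_group S"] by simp
  qed
  have "w \<in> ?gen" if "set w \<subseteq> S \<times> UNIV" "reduced w" for w
    using that
  proof (induction w)
    case Nil
    show ?case using generate.one[of "free_group S"] by (simp add: free_group_def)
  next
    case (Cons x w)
    hence w: "w \<in> ?gen" by (auto simp: reduced_def successively_Cons)
    have "[x] \<otimes>\<^bsub>free_group S\<^esub> w = x # w"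
      using Cons.prems by (cases w) (auto simp: free_group_def reduced_def)
    thus ?case using generate.eng[OF letter w, of x] Cons.prems by simp
  qed
  thus "carrier (free_group S) \<subseteq> ?gen" by (auto simp: free_group_def)
qed

text \<open>
  A free group whose abelianisation is cyclic has rank at most one: the coordinate functions
  belonging to different basis elements are linearly independent homomorphisms to the integers,
  while all homomorphisms to the integers are determined by their value at \<open>g\<close>.
\<close>

lemma (in group) free_group_with_cyclic_abelianisation_is_cyclic:
  assumes free: "is_free_group G" and g: "generates_abelianisation G g"
  shows "\<exists>c \<in> carrier G. generate G {c} = carrier G"
proof -
  obtain S :: "'a set" where "G \<cong> free_group S" using free unfolding is_free_group_def by blast
  moreover from this have "free_group S \<cong> G" by (rule iso_sym)
  ultimately obtain k k' where k: "k \<in> iso (free_group S) G" and k': "k' \<in> iso G (free_group S)"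
    by (auto simp: is_iso_def)
  define gens where "gens = (\<lambda>s. [(s, True)]) ` S"
  have gens: "gens \<subseteq> carrier (free_group S)"
    by (auto simp: gens_def free_group_def reduced_def)
  \<comment> \<open>For different basis elements \<open>s\<close>, \<open>t\<close> let \<open>E s\<close>, \<open>E t\<close> be the corresponding coordinates
      \<open>G \<rightarrow> \<int>\<close>. The combination \<open>E t g * E s - E s g * E t\<close> vanishes at \<open>g\<close>, hence everywhere;
      evaluated at \<open>s\<close> it yields \<open>E t g = 0\<close>, and then \<open>E t\<close> itself vanishes, but it is \<open>1\<close> at \<open>t\<close>.\<close>
  have at_most_one: "s = t" if s: "s \<in> S" and t: "t \<in> S" for s t
  proof (rule ccontr)
    assume "s \<noteq> t"
    have "\<exists>h \<in> hom (free_group S) integer_group. \<forall>r \<in> S. h [(r, True)] = (if r = u then 1 else 0)" for u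
      by (rule free_group_extend) auto
    then obtain e where e: "\<And>u. e u \<in> hom (free_group S) integer_group"
      "\<And>u r. r \<in> S \<Longrightarrow> e u [(r, True)] = (if r = u then 1 else 0)"
      by metis
    define E where "E u = e u \<circ> k'" for u
    have E: "E u \<in> hom G integer_group" for u
      unfolding E_def using Group.hom_compose[OF _ e(1)] k' by (auto simp: iso_def)
    have Eadd: "E u (x \<otimes> y) = E u x + E u y" if "x \<in> carrier G" "y \<in> carrier G" for u x y
      using hom_mult[OF E that] by simp
    have nontriv: "\<exists>x \<in> carrier G. E u x \<noteq> 0 \<and> E v x = 0" if "u \<in> S" "v \<noteq> u" for u v
    proof -
      have "[(u, True)] \<in> k' ` carrier G" using k' gens that by (auto simp: iso_def bij_betw_def gens_def)
      then obtain x where "x \<in> carrier G" "k' x = [(u, True)]" by auto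
      thus ?thesis using e(2) that by (intro bexI[of _ x]) (auto simp: E_def)
    qed
    have gc: "g \<in> carrier G" using g by (simp add: generates_abelianisation_def)
    have comb: "E t g * E s x = E s g * E t x" if x: "x \<in> carrier G" for x
    proof -
      have "(\<lambda>x. E t g * E s x - E s g * E t x) \<in> hom G integer_group"
        by (auto simp: hom_def Eadd algebra_simps)
      from hom_trivial_if_kills_abelianisation_generator[OF g abelian_integer_group this _ x]
      show ?thesis by simp
    qed
    obtain x where "x \<in> carrier G" "E s x \<noteq> 0" "E t x = 0"
      using nontriv[OF s, of t] \<open>s \<noteq> t\<close> by auto
    hence "E t g = 0" using comb[of x] by simp
    hence "E t x = 0" if "x \<in> carrier G" for x
      using hom_trivial_if_kills_abelianisation_generator[OF g abelian_integer_group E[of t] _ that] by simp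
    thus False using nontriv[OF t] \<open>s \<noteq> t\<close> by blast
  qed
  interpret k: group_hom "free_group S" G k
    using k by (simp add: group_hom_def group_hom_axioms_def group_free_group is_group iso_def)
  have "carrier G = k ` generate (free_group S) gens"
    using k by (simp add: gens_def generate_free_group iso_def bij_betw_def)
  also have "\<dots> = generate G (k ` gens)" using k.generate_img[OF gens] by simp
  finally have carr: "carrier G = generate G (k ` gens)" .
  show ?thesis
  proof (cases "S = {}")
    case True
    thus ?thesis using carr generate_empty generate_one by (intro bexI[of _ \<one>]) (auto simp: gens_def)
  next
    case False
    then obtain s where "s \<in> S" by blast
    hence "S = {s}" using at_most_one by blast
    hence gens_eq: "gens = {[(s, True)]}" by (simp add: gens_def)
    have "k [(s, True)] \<in> carrier G" using gens k.hom_closed unfolding gens_eq by blast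
    moreover have "generate G {k [(s, True)]} = carrier G" using carr unfolding gens_eq by simp
    ultimately show ?thesis by blast
  qed
qed

section \<open>Solvable groups\<close>

text \<open>
  The abelianisation of \<open>G/N\<close> is generated by the image of \<open>g\<close>, which is trivial. Hence \<open>G/N\<close>
  equals its own derived subgroup, and being solvable it is trivial.
\<close>

lemma (in group) normal_containing_abelianisation_generator_if_solvable:
  assumes solv: "solvable G" and g: "generates_abelianisation G g"
    and N: "N \<lhd> G" "g \<in> N"
  shows "N = carrier G"
proof -
  interpret \<pi>: group_hom G "G Mod N" "\<lambda>x. N #> x" using group_hom_Mod N(1) by blast
  define Q where "Q = G Mod N"
  interpret Q: group Q unfolding Q_def by (rule \<pi>.H.is_group)
  define P where "P = derived Q (carrier Q)"
  have P: "P \<lhd> Q" unfolding P_def by (rule Q.derived_self_is_normal)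
  have comm: "comm_group (Q Mod P)" unfolding P_def by (rule Q.derived_quot_is_comm_group)
  have subP: "subgroup P Q" by (rule normal_imp_subgroup[OF P])
  have h: "(\<lambda>y. P #>\<^bsub>Q\<^esub> y) \<circ> (\<lambda>x. N #> x) \<in> hom G (Q Mod P)"
    using normal.r_coset_hom_Mod[OF P] normal.r_coset_hom_Mod[OF N(1)]
    by (intro Group.hom_compose[of _ _ Q]) (simp_all add: Q_def)
  have "N #> g = \<one>\<^bsub>Q\<^esub>"
    using g N coset_join2[of g N] by (simp add: Q_def generates_abelianisation_def normal_imp_subgroup)
  hence hg: "((\<lambda>y. P #>\<^bsub>Q\<^esub> y) \<circ> (\<lambda>x. N #> x)) g = \<one>\<^bsub>Q Mod P\<^esub>"
    using Q.coset_mult_one[OF subgroup.subset[OF subP]] by simp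
  have "carrier Q \<subseteq> P"
  proof
    fix q assume q: "q \<in> carrier Q"
    then obtain x where x: "x \<in> carrier G" "q = N #> x" by (auto simp: Q_def carrier_FactGroup)
    have "P #>\<^bsub>Q\<^esub> q = P"
      using hom_trivial_if_kills_abelianisation_generator[OF g comm h hg x(1)] x(2) by simp
    thus "q \<in> P" using Q.rcoset_eq_self_iff[OF subP q] by simp
  qed
  hence perfect: "derived Q (carrier Q) = carrier Q"
    using subgroup.subset[OF subP] unfolding P_def by blast
  have "solvable Q"
    unfolding Q_def by (rule \<pi>.surj_hom_imp_solvable[OF _ solv]) (simp add: carrier_FactGroup)
  then obtain n where "(derived Q ^^ n) (carrier Q) = {\<one>\<^bsub>Q\<^esub>}"
    using Q.solvable_iff_trivial_derived_seq by blast
  moreover have "(derived Q ^^ n) (carrier Q) = carrier Q"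
    by (induction n) (simp_all add: perfect)
  ultimately have "carrier (G Mod N) = {N}" by (simp add: Q_def)
  thus ?thesis by (rule trivial_Mod_imp_eq_carrier[OF N(1)])
qed

section \<open>Two generators of coprime orders\<close>

text \<open>
  In a quotient in which the product \<open>xy\<close> becomes trivial, the images of the generators \<open>x\<close> and
  \<open>y\<close> are inverse to each other, so their orders agree. Since these orders divide coprime numbers,
  both images are trivial.
\<close>

lemma (in group) not_finitely_annihilated_if_coprime_two_generated:
  assumes "coprime_two_generated G"
  shows "\<not> finitely_annihilated G"
proof -
  obtain x y where xy: "x \<in> carrier G" "y \<in> carrier G" "generate G {x, y} = carrier G"
    and cop: "coprime (ord x) (ord y)"
    using assms unfolding coprime_two_generated_def by blast
  show ?thesis
  proof (rule not_finitely_annihilatedI)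
    show "x \<otimes> y \<in> carrier G" using xy by simp
    fix N assume N: "N \<lhd> G" "x \<otimes> y \<in> N"
    interpret N: normal N G by fact
    interpret Q: group "G Mod N" by (rule N.factorgroup_is_group)
    have c: "N #> x \<in> carrier (G Mod N)" "N #> y \<in> carrier (G Mod N)"
      using xy by (auto simp: carrier_FactGroup)
    have dvd: "Q.ord (N #> z) dvd ord z" if z: "z \<in> carrier G" for z
    proof -
      have "(N #> z) [^]\<^bsub>G Mod N\<^esub> ord z = \<one>\<^bsub>G Mod N\<^esub>"
        using N.FactGroup_pow[OF z] z N.subset by simp
      thus ?thesis using Q.pow_eq_id z by (auto simp: carrier_FactGroup)
    qed
    have "(N #> x) \<otimes>\<^bsub>G Mod N\<^esub> (N #> y) = \<one>\<^bsub>G Mod N\<^esub>"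
      using xy N(2) N.rcos_sum coset_join2[of "x \<otimes> y" N] N.is_subgroup by simp
    hence "N #> x = inv\<^bsub>G Mod N\<^esub> (N #> y)" using Q.inv_equality c by metis
    hence "Q.ord (N #> x) = Q.ord (N #> y)" using Q.ord_inv c by simp
    hence "Q.ord (N #> x) = 1" "Q.ord (N #> y) = 1"
      using dvd xy cop by (metis coprime_common_divisor_nat One_nat_def)+
    hence "N #> x = N" "N #> y = N" using Q.ord_eq_1 c by simp_all
    hence "{x, y} \<subseteq> N" using rcoset_eq_self_iff N.is_subgroup xy by blast
    thus "N = carrier G" using subgroup_eq_carrierI N.is_subgroup xy(3) by blast
  qed
qed


section \<open>Finitely many finite simple quotients\<close>

text \<open>
  Each such \<open>N\<close> is the kernel of a homomorphism to the finite group \<open>P\<close>, and a homomorphism is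
  determined by its values on the finitely many generators.
\<close>

lemma (in group) finite_normal_subgroups_with_quotient:
  assumes S: "finite S" "S \<subseteq> carrier G" "generate G S = carrier G"
    and P: "group P" "finite (carrier P)"
  shows "finite {N. N \<lhd> G \<and> G Mod N \<cong> P}" (is "finite ?\<N>")
proof -
  have "\<exists>f. f \<in> hom G P \<and> kernel G P f = N" if "N \<in> ?\<N>" for N
  proof -
    have N: "N \<lhd> G" and "G Mod N \<cong> P" using that by auto
    then obtain i where i: "i \<in> iso (G Mod N) P" by (auto simp: is_iso_def)
    interpret N: normal N G by fact
    interpret i: group_hom "G Mod N" P i
      using i P(1) N.factorgroup_is_group by (simp add: group_hom_def group_hom_axioms_def iso_def)
    have inj: "inj_on i (carrier (G Mod N))" using i by (simp add: iso_iff)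
    have "i (N #> x) = \<one>\<^bsub>P\<^esub> \<longleftrightarrow> x \<in> N" if x: "x \<in> carrier G" for x
    proof -
      have "N #> x \<in> carrier (G Mod N)" using x by (auto simp: carrier_FactGroup)
      hence "i (N #> x) = i \<one>\<^bsub>G Mod N\<^esub> \<longleftrightarrow> N #> x = \<one>\<^bsub>G Mod N\<^esub>"
        using inj_on_eq_iff[OF inj _ i.G.one_closed] by blast
      thus ?thesis using rcoset_eq_self_iff[OF N.is_subgroup x] unfolding i.hom_one by simp
    qed
    hence "kernel G P (i \<circ> (\<lambda>x. N #> x)) = N"
      using N.subset by (auto simp: kernel_def)
    thus ?thesis using Group.hom_compose[OF N.r_coset_hom_Mod i.homh] by blast
  qed
  hence "\<forall>N \<in> ?\<N>. \<exists>f. f \<in> hom G P \<and> kernel G P f = N" by blast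
  then obtain f where "\<forall>N \<in> ?\<N>. f N \<in> hom G P \<and> kernel G P (f N) = N"
    by (rule bchoice[THEN exE])
  hence f: "f N \<in> hom G P" "kernel G P (f N) = N" if "N \<in> ?\<N>" for N
    using that by (simp_all only: Ball_def)
  have "inj_on (\<lambda>N. restrict (f N) S) ?\<N>"
  proof (rule inj_onI)
    fix M N assume M: "M \<in> ?\<N>" and N: "N \<in> ?\<N>" and eq: "restrict (f M) S = restrict (f N) S"
    have "f M s = f N s" if "s \<in> S" for s using fun_cong[OF eq, of s] that by simp
    hence "f M x = f N x" if "x \<in> carrier G" for x
      by (rule hom_eq_on_generators[OF is_group P(1) f(1)[OF M] f(1)[OF N] S(2,3) _ that])
    hence "kernel G P (f M) = kernel G P (f N)" by (auto simp: kernel_def)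
    thus "M = N" using f(2)[OF M] f(2)[OF N] by simp
  qed
  moreover have "(\<lambda>N. restrict (f N) S) ` ?\<N> \<subseteq> S \<rightarrow>\<^sub>E carrier P"
  proof (rule image_subsetI)
    fix N assume "N \<in> ?\<N>"
    hence "f N \<in> carrier G \<rightarrow> carrier P" using f(1)[of N] by (simp add: hom_def)
    thus "restrict (f N) S \<in> S \<rightarrow>\<^sub>E carrier P" using S(2) by auto
  qed
  ultimately show ?thesis
    using finite_PiE[of S "\<lambda>_. carrier P"] S(1) P(2) by (meson finite_imageD finite_subset)
qed

lemma (in group) finite_simple_quotient_kernels:
  assumes fg: "finitely_generated_group G" and fin: "fin_many_finite_simple_quotients G"
  shows "finite {N. N \<lhd> G \<and> finite (carrier (G Mod N)) \<and> simple_group (G Mod N)}" (is "finite ?\<M>")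
proof -
  obtain S where S: "finite S" "S \<subseteq> carrier G" "generate G S = carrier G"
    using fg unfolding finitely_generated_group_def by blast
  define Q where "Q = finite_simple_quotients G"
  define R where "R = {(P, P'). P \<in> Q \<and> P' \<in> Q \<and> P \<cong> P'}"
  have "finite (Q // R)"
    using fin unfolding fin_many_finite_simple_quotients_def Q_def R_def .
  moreover have "finite {N. N \<lhd> G \<and> G Mod N \<in> C}" if "C \<in> Q // R" for C
  proof -
    obtain P where P: "P \<in> Q" "C = R `` {P}" using \<open>C \<in> Q // R\<close> unfolding quotient_def by blast
    then obtain K where K: "P = G Mod K" "K \<lhd> G" "finite (carrier P)"
      by (auto simp: Q_def finite_simple_quotients_def)
    hence grp: "group P" by (simp add: normal.factorgroup_is_group)
    have "{N. N \<lhd> G \<and> G Mod N \<in> C} \<subseteq> {N. N \<lhd> G \<and> G Mod N \<cong> P}"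
      using P(2) group.iso_sym[OF grp] by (auto simp: R_def)
    thus ?thesis
      using finite_normal_subgroups_with_quotient[OF S grp K(3)] finite_subset by blast
  qed
  moreover have "?\<M> \<subseteq> (\<Union>C \<in> Q // R. {N. N \<lhd> G \<and> G Mod N \<in> C})"
  proof
    fix N assume "N \<in> ?\<M>"
    hence N: "N \<lhd> G" "G Mod N \<in> Q" by (auto simp: Q_def finite_simple_quotients_def)
    hence "R `` {G Mod N} \<in> Q // R" by (intro quotientI)
    moreover have "G Mod N \<in> R `` {G Mod N}" using N(2) by (simp add: R_def)
    ultimately show "N \<in> (\<Union>C \<in> Q // R. {N. N \<lhd> G \<and> G Mod N \<in> C})" using N(1) by blast
  qed
  ultimately show ?thesis by (meson finite_UN_I finite_subset)
qed

lemma (in group) finite_Mod_mono: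
  assumes N: "subgroup N G" "finite (carrier (G Mod N))" and M: "subgroup M G" "N \<subseteq> M"
  shows "finite (carrier (G Mod M))"
proof (rule finite_surj[OF N(2)])
  show "carrier (G Mod M) \<subseteq> (\<lambda>Y. M <#> Y) ` carrier (G Mod N)"
  proof
    fix Z assume "Z \<in> carrier (G Mod M)"
    then obtain x where x: "x \<in> carrier G" "Z = M #> x" by (auto simp: carrier_FactGroup)
    have sub: "M \<subseteq> carrier G" "N \<subseteq> carrier G" using M(1) N(1) by (auto dest: subgroup.subset)
    have "M <#> N \<subseteq> M" using subgroup.m_closed[OF M(1)] M(2) by (auto simp: set_mult_def)
    moreover have "M \<subseteq> M <#> N"
    proof
      fix m assume m: "m \<in> M"
      hence "m = m \<otimes> \<one>" using sub by auto
      thus "m \<in> M <#> N" using m subgroup.one_closed[OF N(1)] unfolding set_mult_def by blast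
    qed
    ultimately have "Z = M <#> (N #> x)"
      using setmult_rcos_assoc[OF sub x(1)] x(2) by simp
    thus "Z \<in> (\<lambda>Y. M <#> Y) ` carrier (G Mod N)" using x(1) by (auto simp: carrier_FactGroup)
  qed
qed

text \<open>
  A maximal proper normal subgroup above \<open>N\<close> does it. It exists because normal subgroups above
  \<open>N\<close> are unions of cosets of \<open>N\<close>, of which there are finitely many.
\<close>

lemma (in group) proper_normal_below_simple_quotient_kernel:
  assumes N: "N \<lhd> G" "finite (carrier (G Mod N))" "N \<noteq> carrier G"
  obtains M where "M \<lhd> G" "N \<subseteq> M" "finite (carrier (G Mod M))" "simple_group (G Mod M)"
proof -
  interpret N: normal N G by fact
  define \<A> where "\<A> = {M. M \<lhd> G \<and> N \<subseteq> M \<and> M \<noteq> carrier G}"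
  have "M = \<Union>((\<lambda>x. N #> x) ` M)" if "M \<in> \<A>" for M
  proof
    have M: "subgroup M G" "N \<subseteq> M" using that by (auto simp: \<A>_def normal_imp_subgroup)
    have "x \<in> N #> x" if "x \<in> M" for x
      using that subgroup.subset[OF M(1)] rcos_self[OF _ N.is_subgroup] by blast
    thus "M \<subseteq> \<Union>((\<lambda>x. N #> x) ` M)" by blast
    show "\<Union>((\<lambda>x. N #> x) ` M) \<subseteq> M"
      using M(2) subgroup.m_closed[OF M(1)] by (auto simp: r_coset_def)
  qed
  moreover have "(\<lambda>x. N #> x) ` M \<in> Pow (carrier (G Mod N))" if "M \<in> \<A>" for M
    using that subgroup.subset[OF normal_imp_subgroup, of M] by (auto simp: \<A>_def carrier_FactGroup)
  ultimately have "\<A> \<subseteq> Union ` Pow (carrier (G Mod N))" by (rule subsetI[OF image_eqI])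
  hence "finite \<A>" using N(2) finite_surj[of "Pow (carrier (G Mod N))"] by simp
  moreover have "N \<in> \<A>" using N by (simp add: \<A>_def)
  ultimately obtain M where M: "M \<in> \<A>" and max: "\<forall>L \<in> \<A>. M \<subseteq> L \<longrightarrow> M = L"
    using finite_has_maximal2[of \<A> N] by blast
  have MG: "M \<lhd> G" "N \<subseteq> M" "M \<noteq> carrier G" using M by (auto simp: \<A>_def)
  interpret M: normal M G by fact
  interpret Q: group "G Mod M" by (rule M.factorgroup_is_group)
  have fin: "finite (carrier (G Mod M))"
    using finite_Mod_mono[OF N.is_subgroup N(2) M.is_subgroup MG(2)] .
  have "simple_group (G Mod M)"
  proof (rule simple_group.intro[OF Q.is_group], unfold_locales)
    have "order (G Mod M) \<noteq> 1"
      using Q.order_one_triv_iff trivial_Mod_imp_eq_carrier MG by auto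
    moreover have "order (G Mod M) > 0" using fin Q.order_gt_0_iff_finite by blast
    ultimately show "1 < order (G Mod M)" by simp
  next
    fix K assume K: "K \<lhd> G Mod M"
    have subK: "subgroup K (G Mod M)" using K by (rule normal_imp_subgroup)
    have UK: "\<Union>K = {x \<in> carrier G. M #> x \<in> K}"
      by (rule M.factgroup_subgroup_union_char[OF subK])
    have K_eq: "K = (\<lambda>x. M #> x) ` \<Union>K"
      using subgroup.subset[OF subK] unfolding UK by (auto simp: carrier_FactGroup)
    have "M \<in> K" using subgroup.one_closed[OF subK] by simp
    hence sub: "M \<subseteq> \<Union>K" by blast
    have nrm: "\<Union>K \<lhd> G" by (rule M.factgroup_subgroup_union_normal[OF K])
    show "K = carrier (G Mod M) \<or> K = {\<one>\<^bsub>G Mod M\<^esub>}"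
    proof (cases "\<Union>K = carrier G")
      case True
      thus ?thesis using K_eq by (simp add: carrier_FactGroup)
    next
      case False
      hence "M = \<Union>K" using max nrm sub MG(2) by (auto simp: \<A>_def)
      hence "K = (\<lambda>x. M #> x) ` M" using K_eq by simp
      also have "\<dots> = (\<lambda>x. M) ` M"
        using coset_join2[OF M.mem_carrier M.is_subgroup] by (intro image_cong) auto
      also have "\<dots> = {M}" using M.one_closed by blast
      finally show ?thesis by simp
    qed
  qed
  with that MG fin show thesis by blast
qed

text \<open>
  The image of \<open>A\<close> in the simple group \<open>G/M\<close> is normal, so it is trivial or everything.
\<close>

lemma (in group) normal_supplements_simple_quotient_kernel:
  assumes M: "M \<lhd> G" "simple_group (G Mod M)" and A: "A \<lhd> G" "\<not> A \<subseteq> M" and x: "x \<in> carrier G"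
  shows "\<exists>a \<in> A. M #> x = M #> a"
proof -
  interpret S: simple_group "G Mod M" by fact
  have "(\<lambda>x. M #> x) ` A \<lhd> G Mod M"
    by (rule normal.surj_hom_normal_subgroup[OF A(1) group_hom_Mod[OF M(1)]])
      (simp add: carrier_FactGroup)
  from S.no_real_normal_subgroup[OF this]
  have "(\<lambda>x. M #> x) ` A = carrier (G Mod M) \<or> (\<lambda>x. M #> x) ` A = {M}" by simp
  moreover have "(\<lambda>x. M #> x) ` A \<noteq> {M}"
  proof
    assume triv: "(\<lambda>x. M #> x) ` A = {M}"
    have "a \<in> M" if "a \<in> A" for a
      using triv that rcoset_eq_self_iff[OF normal_imp_subgroup[OF M(1)], of a]
        subgroup.mem_carrier[OF normal_imp_subgroup[OF A(1)] that] by blast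
    thus False using A(2) by blast
  qed
  ultimately have "M #> x \<in> (\<lambda>x. M #> x) ` A" using x by (simp add: carrier_FactGroup)
  thus ?thesis by blast
qed

lemma (in group) simple_quotient_kernels_incomparable:
  assumes M: "M \<lhd> G" "simple_group (G Mod M)" and K: "K \<lhd> G" "simple_group (G Mod K)"
    and "K \<subseteq> M"
  shows "K = M"
proof (rule ccontr)
  assume "K \<noteq> M"
  hence "\<not> M \<subseteq> K" using \<open>K \<subseteq> M\<close> by blast
  note supp = normal_supplements_simple_quotient_kernel[OF K M(1) this]
  interpret M: normal M G by (rule M(1))
  have "x \<in> M" if x: "x \<in> carrier G" for x
  proof -
    obtain m where m: "m \<in> M" "K #> x = K #> m" using supp[OF x] by blast
    hence "x \<in> K #> m" using rcos_self[OF x normal_imp_subgroup[OF K(1)]] by simp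
    thus ?thesis using m(1) \<open>K \<subseteq> M\<close> by (auto simp: r_coset_def)
  qed
  hence "M = carrier G" using M.subset by blast
  thus False using self_factor_not_simple M(2) by blast
qed

text \<open>
  The analogue of a prime ideal, with commutators in the role of products. If neither \<open>A\<close> nor \<open>B\<close>
  lay in \<open>M\<close>, then any two elements of \<open>G/M\<close> would be represented by some \<open>a \<in> A\<close> and \<open>b \<in> B\<close>,
  whose commutator lies in \<open>A \<inter> B \<subseteq> M\<close>; so \<open>G/M\<close> would be abelian.
\<close>

lemma (in group) nonabelian_simple_quotient_kernel_prime:
  assumes M: "M \<lhd> G" "simple_group (G Mod M)" "\<not> derived G (carrier G) \<subseteq> M"
    and A: "A \<lhd> G" and B: "B \<lhd> G" and AB: "A \<inter> B \<subseteq> M"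
  shows "A \<subseteq> M \<or> B \<subseteq> M"
proof (rule ccontr)
  assume "\<not> (A \<subseteq> M \<or> B \<subseteq> M)"
  hence nA: "\<not> A \<subseteq> M" and nB: "\<not> B \<subseteq> M" by auto
  interpret M: normal M G by (rule M(1))
  interpret A: normal A G by (rule A)
  interpret B: normal B G by (rule B)
  interpret Q: group "G Mod M" by (rule M.factorgroup_is_group)
  have "comm_group (G Mod M)"
  proof (rule Q.group_comm_groupI)
    fix Y Z assume "Y \<in> carrier (G Mod M)" "Z \<in> carrier (G Mod M)"
    then obtain y z where yz: "y \<in> carrier G" "z \<in> carrier G" "Y = M #> y" "Z = M #> z"
      by (auto simp: carrier_FactGroup)
    obtain a where a: "a \<in> A" "Y = M #> a"
      using normal_supplements_simple_quotient_kernel[OF M(1,2) A nA yz(1)] yz(3) by blast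
    obtain b where b: "b \<in> B" "Z = M #> b"
      using normal_supplements_simple_quotient_kernel[OF M(1,2) B nB yz(2)] yz(4) by blast
    have ab: "a \<in> carrier G" "b \<in> carrier G" using a b A.subset B.subset by auto
    define c where "c = a \<otimes> b \<otimes> inv a \<otimes> inv b"
    have "c = a \<otimes> (b \<otimes> inv a \<otimes> inv b)" using ab by (simp add: c_def m_assoc)
    hence "c \<in> A" using a(1) ab(2) A.inv_op_closed2[of b "inv a"] by simp
    moreover have "c \<in> B" using b(1) ab(1) B.inv_op_closed2[of a b] by (simp add: c_def)
    ultimately have c: "c \<in> M" using AB by blast
    have "inv b \<otimes> (b \<otimes> a) = a" using ab by (simp flip: m_assoc)
    hence "a \<otimes> b = c \<otimes> (b \<otimes> a)" using ab by (simp add: c_def m_assoc)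
    hence "M #> (a \<otimes> b) = (M #> c) #> (b \<otimes> a)"
      using ab c M.subset by (subst coset_mult_assoc) auto
    also have "\<dots> = M #> (b \<otimes> a)"
      using c M.subset coset_join2[OF _ M.is_subgroup c] by auto
    finally show "Y \<otimes>\<^bsub>G Mod M\<^esub> Z = Z \<otimes>\<^bsub>G Mod M\<^esub> Y"
      using a(2) b(2) ab by (simp add: M.rcos_sum)
  qed
  thus False using derived_minimal[OF M(1)] M(3) by blast
qed

lemma (in group) nonabelian_simple_quotient_kernel_prime_Inter:
  assumes M: "M \<lhd> G" "simple_group (G Mod M)" "\<not> derived G (carrier G) \<subseteq> M"
    and "finite \<F>" "\<forall>K \<in> \<F>. K \<lhd> G" "A \<lhd> G" "A \<inter> \<Inter>\<F> \<subseteq> M"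
  shows "A \<subseteq> M \<or> (\<exists>K \<in> \<F>. K \<subseteq> M)"
  using assms(4-)
proof (induction \<F> arbitrary: A rule: finite_induct)
  case (insert K \<F>)
  have "A \<inter> K \<lhd> G" using insert.prems by (simp add: normal_subgroup_intersect)
  moreover have "A \<inter> K \<inter> \<Inter>\<F> \<subseteq> M" using insert.prems by auto
  ultimately have "A \<inter> K \<subseteq> M \<or> (\<exists>K \<in> \<F>. K \<subseteq> M)"
    using insert.IH insert.prems(1) by simp
  moreover have "A \<subseteq> M \<or> K \<subseteq> M" if "A \<inter> K \<subseteq> M"
    using nonabelian_simple_quotient_kernel_prime[OF M _ _ that] insert.prems by simp
  ultimately show ?case by blast
qed simp

text \<open>
  Prime avoidance. Suppose \<open>dg\<close> avoids the kernels in \<open>\<F>\<close> but lies in a further one, \<open>K\<close>. By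
  primeness and maximality \<open>K\<close> does not contain the intersection of \<open>G'\<close> with the members of \<open>\<F>\<close>.
  Multiplying \<open>dg\<close> by an element \<open>m\<close> of this intersection outside \<open>K\<close> moves it out of \<open>K\<close>, without
  moving it into a member of \<open>\<F>\<close>.
\<close>

lemma (in group) derived_coset_avoids_nonabelian_simple_quotient_kernels:
  assumes "finite \<F>" and g: "g \<in> carrier G"
    and "\<forall>K \<in> \<F>. K \<lhd> G \<and> simple_group (G Mod K) \<and> \<not> derived G (carrier G) \<subseteq> K"
  shows "\<exists>d \<in> derived G (carrier G). \<forall>K \<in> \<F>. d \<otimes> g \<notin> K"
  using assms(1,3)
proof (induction \<F> rule: finite_induct)
  case empty
  show ?case using generate.one[of G] unfolding derived_def by auto
next
  case (insert K \<F>)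
  let ?D = "derived G (carrier G)"
  have D: "?D \<lhd> G" by (rule derived_self_is_normal)
  have K: "K \<lhd> G" "simple_group (G Mod K)" "\<not> ?D \<subseteq> K" using insert.prems by auto
  obtain d where d: "d \<in> ?D" "\<forall>L \<in> \<F>. d \<otimes> g \<notin> L" using insert by auto
  have dc: "d \<in> carrier G" using d(1) derived_in_carrier by blast
  show ?case
  proof (cases "d \<otimes> g \<in> K")
    case False
    thus ?thesis using d by blast
  next
    case True
    have "\<not> L \<subseteq> K" if "L \<in> \<F>" for L
      using simple_quotient_kernels_incomparable[OF K(1,2)] insert that by blast
    hence "\<not> ?D \<inter> \<Inter>\<F> \<subseteq> K"
      using nonabelian_simple_quotient_kernel_prime_Inter[OF K insert.hyps(1) _ D] insert.prems K(3)
      by blast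
    then obtain m where m: "m \<in> ?D" "\<forall>L \<in> \<F>. m \<in> L" "m \<notin> K" by blast
    have mc: "m \<in> carrier G" using m(1) derived_in_carrier by blast
    have cancel: "m \<otimes> d \<otimes> g \<in> L \<longleftrightarrow> d \<otimes> g \<in> L" if "L \<lhd> G" "m \<in> L" for L
    proof -
      interpret L: normal L G by fact
      have "inv m \<otimes> (m \<otimes> d \<otimes> g) = d \<otimes> g" using mc dc g by (simp flip: m_assoc)
      moreover have "m \<otimes> d \<otimes> g = m \<otimes> (d \<otimes> g)" using mc dc g by (simp add: m_assoc)
      ultimately show ?thesis using that(2) L.m_closed L.m_inv_closed by metis
    qed
    have "m \<otimes> d \<otimes> g \<notin> K"
    proof
      interpret K: normal K G by (rule K(1))
      assume "m \<otimes> d \<otimes> g \<in> K"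
      hence "m \<otimes> d \<otimes> g \<otimes> inv (d \<otimes> g) \<in> K" using True K.m_closed K.m_inv_closed by blast
      moreover have "m \<otimes> d \<otimes> g \<otimes> inv (d \<otimes> g) = m"
        using mc dc g by (simp add: m_assoc)
      ultimately show False using m(3) by simp
    qed
    moreover have "m \<otimes> d \<otimes> g \<notin> L" if "L \<in> \<F>" for L
      using cancel[of L] m(2) d(2) insert.prems that by blast
    moreover have "m \<otimes> d \<in> ?D"
      using m(1) d(1) subgroup.m_closed[OF normal_imp_subgroup[OF D]] by blast
    ultimately show ?thesis by blast
  qed
qed

text \<open>
  A proper normal subgroup of finite index lies in the kernel \<open>M\<close> of a finite simple quotient. If
  \<open>M\<close> does not contain \<open>G'\<close>, it misses \<open>dg\<close> by the choice of \<open>d\<close>; if it does, it contains \<open>dg\<close>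
  only together with \<open>g\<close>.
\<close>

lemma (in group) not_finitely_annihilated_if_fin_many_finite_simple_quotients:
  assumes fg: "finitely_generated_group G" and fin: "fin_many_finite_simple_quotients G"
    and g: "generates_abelianisation G g"
  shows "\<not> finitely_annihilated G"
proof -
  let ?D = "derived G (carrier G)"
  let ?\<M> = "{N. N \<lhd> G \<and> finite (carrier (G Mod N)) \<and> simple_group (G Mod N)}"
  have gc: "g \<in> carrier G" using g by (simp add: generates_abelianisation_def)
  have "finite {N \<in> ?\<M>. \<not> ?D \<subseteq> N}" using finite_simple_quotient_kernels[OF fg fin] by (rule rev_finite_subset) auto
  then obtain d where d: "d \<in> ?D" "\<forall>N \<in> {N \<in> ?\<M>. \<not> ?D \<subseteq> N}. d \<otimes> g \<notin> N"
    using derived_coset_avoids_nonabelian_simple_quotient_kernels[OF _ gc] by blast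
  have dc: "d \<in> carrier G" using d(1) derived_in_carrier by blast
  show ?thesis
  proof (rule not_finitely_annihilatedI)
    show "d \<otimes> g \<in> carrier G" using dc gc by simp
    fix N assume N: "N \<lhd> G" "finite (carrier (G Mod N))" "d \<otimes> g \<in> N"
    show "N = carrier G"
    proof (rule ccontr)
      assume "N \<noteq> carrier G"
      then obtain M where M: "M \<lhd> G" "N \<subseteq> M" "finite (carrier (G Mod M))" "simple_group (G Mod M)"
        using proper_normal_below_simple_quotient_kernel N(1,2) by blast
      interpret M: normal M G by (rule M(1))
      have dg: "d \<otimes> g \<in> M" using M(2) N(3) by blast
      hence D: "?D \<subseteq> M" using d(2) M by blast
      have "inv d \<otimes> (d \<otimes> g) \<in> M" using dg d(1) D M.m_closed M.m_inv_closed by blast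
      hence "g \<in> M" using dc gc by (simp flip: m_assoc)
      hence "M = carrier G" using g D M(1) unfolding generates_abelianisation_def by blast
      thus False using self_factor_not_simple M(4) by blast
    qed
  qed
qed

section \<open>The equivalence\<close>

theorem theorem5p11:
  fixes G :: "('a, 'b) monoid_scheme"
  assumes "group G"
    and "finitely_generated_group G"
    and "is_free_group G \<or> solvable G \<or> fin_many_finite_simple_quotients G \<or>
         coprime_two_generated G"
  shows "finitely_annihilated G \<longleftrightarrow> \<not> cyclic_group (abelianisation G)"
proof -
  interpret group G by fact
  show ?thesis
  proof
    assume fa: "finitely_annihilated G"
    show "\<not> cyclic_group (abelianisation G)"
    proof
      assume "cyclic_group (abelianisation G)"
      then obtain g where g: "generates_abelianisation G g" using cyclic_abelianisation_iff by blast
      hence gc: "g \<in> carrier G" by (simp add: generates_abelianisation_def)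
      have "\<not> finitely_annihilated G"
        using assms(3)
      proof (elim disjE)
        assume "is_free_group G"
        then obtain c where c: "c \<in> carrier G" "generate G {c} = carrier G"
          using free_group_with_cyclic_abelianisation_is_cyclic g by blast
        show ?thesis
          by (rule not_finitely_annihilatedI[OF c(1)], rule subgroup_eq_carrierI[OF _ _ c(2)])
            (auto simp: normal_imp_subgroup)
      next
        assume "solvable G"
        thus ?thesis
          using not_finitely_annihilatedI[OF gc]
            normal_containing_abelianisation_generator_if_solvable[OF _ g] by blast
      next
        assume "fin_many_finite_simple_quotients G"
        thus ?thesis
          using not_finitely_annihilated_if_fin_many_finite_simple_quotients[OF assms(2) _ g] by blast
      qed (rule not_finitely_annihilated_if_coprime_two_generated)
      thus False using fa by blast
    qed
  next
    assume "\<not> cyclic_group (abelianisation G)"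
    hence no_gen: "\<not> generates_abelianisation G g" for g using cyclic_abelianisation_iff by blast
    have "carrier G \<noteq> {\<one>\<^bsub>G\<^esub>}"
    proof
      assume triv: "carrier G = {\<one>\<^bsub>G\<^esub>}"
      have "N = carrier G" if "N \<lhd> G" for N
        using subgroup.subset[OF normal_imp_subgroup[OF that]]
          subgroup.one_closed[OF normal_imp_subgroup[OF that]] triv by auto
      thus False using no_gen[of "\<one>\<^bsub>G\<^esub>"] unfolding generates_abelianisation_def by blast
    qed
    thus "finitely_annihilated G"
      unfolding finitely_annihilated_def
      using finitely_annihilated_elem_if_abelianisation_not_generated[OF assms(2)] no_gen by blast
  qed
qed

end
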